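(* Consider the system $x_{k+1}=f(x_k,u_k)$ and an STL formula $\Phi$ from the fragment described in the context. The online monitor $\mathcal{M}$ defined by the monitoring algorithm described in the context solves the model-predictive online monitoring problem for this system and $\Phi$. That is, $\mathcal{M}$ is an online monitor $$\mathcal{M}:\mathcal{X}^*\to\{\texttt{vio},\texttt{feas}\}$$ such that, for any prefix $\mathbf{x}_{0:k}=x_0x_1\cdots x_k\in\mathcal{X}^*$: (i) $\mathcal{M}(\mathbf{x}_{0:k})=\texttt{vio}$ if and only if $\mathbf{x}_{0:k}$ is violated, i.e. for every control input sequence $\mathbf{u}_{k:T-1}\in\mathcal{U}^{T-k}$ we have $\mathbf{x}_{0:k}\,\xi_f(x_k,\mathbf{u}_{k:T-1})\not\models\Phi$; (ii) $\mathcal{M}(\mathbf{x}_{0:k})=\texttt{feas}$ if and only if $\mathbf{x}_{0:k}$ is feasible, i.e. for some control input sequence $\mathbf{u}_{k:T-1}\in\mathcal{U}^{T-k}$ we have $\mathbf{x}_{0:k}\,\xi_f(x_k,\mathbf{u}_{k:T-1})\models\Phi$.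
   Context: **System.** $\mathcal{X}\subset\mathbb{R}^n$ and $\mathcal{U}\subset\mathbb{R}^m$ are bounded, and $f:\mathcal{X}\times\mathcal{U}\to\mathcal{X}$ is continuous. Time instants are integers $0\le k\le T$, where $T$ is the operation horizon. For $x_k\in\mathcal{X}$ and $\mathbf{u}_{k:T-1}=u_k\cdots u_{T-1}\in\mathcal{U}^{T-k}$, $\xi_f(x_k,\mathbf{u}_{k:T-1})=x_{k+1}\cdots x_T$ with $x_{i+1}=f(x_i,u_i)$ for $i=k,\dots,T-1$ (the empty sequence if $k=T$). All time intervals $[a,b]$ are sets of integers, $0\le a\le b$. $\mathcal{X}^*$ denotes finite state sequences (prefixes). **Formulae.** $\Phi ::= \mathbf{G}_{[a,b]}\Phi \mid \Phi_1\mathbf{U}'_{[a,b]}\Phi_2\mid\Phi_1\wedge\Phi_2\mid x\in\mathcal{H}$, where $\mathcal{H}\subseteq\mathcal{X}$ is the satisfaction region of a Boolean formula (built by negation and conjunction from "true" and atomic predicates $\mu(x)\ge0$, $\mu:\mathbb{R}^n\to\mathbb{R}$). Semantics for a state sequence $\mathbf{x}=x_0x_1\cdots$ at instant $k$: $(\mathbf{x},k)\models x\in\mathcal{H}$ iff $x_k\in\mathcal{H}$; conjunction is standard; $(\mathbf{x},k)\models\mathbf{G}_{[a,b]}\Phi$ iff $(\mathbf{x},k')\models\Phi$ for all $k'\in[k+a,k+b]$; $(\mathbf{x},k)\models\Phi_1\mathbf{U}'_{[a,b]}\Phi_2$ iff there is $k'\in[k+a,k+b]$ with $(\mathbf{x},k')\models\Phi_2$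 and $(\mathbf{x},k'')\models\Phi_1$ for all $k''\in[k+a,k']$. Write $\mathbf{x}\models\Phi$ for $(\mathbf{x},0)\models\Phi$. The horizon $T$ is assumed sufficiently long to evaluate satisfaction of $\Phi$ on sequences $x_0\cdots x_T$. **Syntax tree.** The formula $\Phi$ is represented by its rooted syntax tree with node set $V=\{v_1,\dots,v_m\}$: a formula $x\in\mathcal{H}$ is a leaf ($\mathcal{H}$-node) $v$ with region $\mathcal{H}^v=\mathcal{H}$; $\Phi_1\wedge\cdots\wedge\Phi_n$ is a $\wedge$-node whose (unordered) children are the roots of the trees of the $\Phi_i$; $\mathbf{G}_{[a,b]}\Phi'$ is a $\mathbf{G}$-node with interval $[a,b]$ and a unique child, the root of the tree of $\Phi'$; $\Phi_1\mathbf{U}'_{[a,b]}\Phi_2$ is a $\mathbf{U}'$-node with interval $[a,b]$, whose left and right children are the roots of the trees of $\Phi_1$ and $\Phi_2$. The interval of node $v$ is denoted $[a^v,b^v]$, with $a^v=b^v=0$ for $\wedge$- and $\mathcal{H}$-nodes. The $\mathcal{H}$-nodes are $v_1,\dots,v_h$. The evaluation horizon of $v$ is $[\mathrm{int}^v,\mathrm{end}^v]=[\sum_{v'}a^{v'},\sum_{v'}b^{v'}]$, sums over all strict ancestors $v'$ of $v$. The root is assumed (without loss of generality) to be a $\wedge$-node; its evaluation horizon is $[0,0]$. **Satisfaction vectors.** A satisfaction vector of $v$ is $\iota^v=(\iota^v[t])_{t\in[\mathrm{int}^v,\mathrm{end}^v]}$ with entries in $\{0,1,?\}$. A basic set is a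 tuple $I=(\iota^{v_1},\dots,\iota^{v_h})$ of satisfaction vectors of the $\mathcal{H}$-nodes. It induces satisfaction vectors of all other nodes bottom-up, for each $t\in[\mathrm{int}^v,\mathrm{end}^v]$: - $\wedge$-node: $\iota^v[t]=0$ if some child $v'$ has $\iota^{v'}[t]=0$; $1$ if all children $v'$ have $\iota^{v'}[t]=1$; $?$ otherwise. - $\mathbf{G}$-node with child $v'$: $\iota^v[t]=0$ if $\iota^{v'}[t+t']=0$ for some $t'\in[a^v,b^v]$; $1$ if $\iota^{v'}[t+t']=1$ for all $t'\in[a^v,b^v]$; $?$ otherwise. - $\mathbf{U}'$-node with left/right children $v_l,v_r$: $\iota^v[t]=0$ if either $\iota^{v_r}[t+t']=0$ for all $t'\in[a^v,b^v]$, or for every $t'\in[a^v,b^v]$ with $\iota^{v_r}[t+t']=1$ there is $t''\in[a^v,t']$ with $\iota^{v_l}[t+t'']=0$; $1$ if there is $t'\in[a^v,b^v]$ with $\iota^{v_r}[t+t']=1$ and $\iota^{v_l}[t+t'']=1$ for all $t''\in[a^v,t']$; $?$ otherwise. $\iota^{\mathrm{root}}_I$ denotes the (single-entry) induced vector of the root, identified with its entry. **Update.** $I_0$ is the basic set with all entries $?$. For a basic set $I_k=(\iota_k^{v_1},\dots,\iota_k^{v_h})$ at instant $k$ and a state $x_k$, $\texttt{update}(I_k,x_k)=(\iota_{k+1}^{v_1},\dots,\iota_{k+1}^{v_h})$ where, for $t\in[\mathrm{int}^{v_i},\mathrm{end}^{v_i}]$, $\iota_{k+1}^{v_i}[t]=\iota_k^{v_i}[t]$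 if $t\ne k$, and for $t=k$ the entry is $1$ if $x_k\in\mathcal{H}^{v_i}$ and $0$ if $x_k\notin\mathcal{H}^{v_i}$. $I(\mathbf{x}_{0:k-1})$ is the basic set obtained from $I_0$ by successively updating with $x_0,\dots,x_{k-1}$, and $\mathbf{x}^I_{0:k-1}=\{\mathbf{x}_{0:k-1}\in\mathcal{X}^k\mid I(\mathbf{x}_{0:k-1})=I\}$. **Feasible sets.** $X_k^I$ is the set of $x_k\in\mathcal{X}$ for which there is $\mathbf{u}_{k:T-1}\in\mathcal{U}^{T-k}$ such that $\mathbf{x}^I_{0:k-1}\,x_k\,\xi_f(x_k,\mathbf{u}_{k:T-1})\models\Phi$, where the latter means that $\mathbf{x}'_{0:k-1}\,x_k\,\xi_f(x_k,\mathbf{u}_{k:T-1})\models\Phi$ for some (equivalently, all) $\mathbf{x}'_{0:k-1}\in\mathbf{x}^I_{0:k-1}$. **Monitoring algorithm.** Input: the feasible sets $X_k^I$, computed offline. Output: the online monitoring decision $\mathcal{M}(\mathbf{x}_{0:k})$, which is the decision issued at instant $k$ after observing $\mathbf{x}_{0:k}$. Start with $k=0$, $I=I_0$. While $\iota^{\mathrm{root}}_I\ne1$: observe the new current state $x_k$; if $x_k\notin X_k^I$, $\mathcal{M}$ issues $\texttt{vio}$ and the algorithm terminates, returning "$\Phi$ is violated"; otherwise $\mathcal{M}$ issues $\texttt{feas}$ and $I\leftarrow\texttt{update}(I,x_k)$; then $k\leftarrow k+1$.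
   Formalization: After the algorithm stops, M keeps its last decision; if it stopped with vio at an instant j<k, the states after x_j are assumed to follow x_{i+1}=f(x_i,u_i) for some u_i in U, since otherwise M issues no decision and the prefix may become feasible again. *)

theory Defs
  imports "HOL-Analysis.Analysis"
begin

datatype 'x bform = BTrue | BPred "'x \<Rightarrow> real" | BNot "'x bform" | BAnd "'x bform" "'x bform"

primrec bsat :: "'x bform \<Rightarrow> 'x \<Rightarrow> bool" where
  "bsat BTrue x \<longleftrightarrow> True"
| "bsat (BPred \<mu>) x \<longleftrightarrow> \<mu> x \<ge> 0"
| "bsat (BNot \<phi>) x \<longleftrightarrow> \<not> bsat \<phi> x"
| "bsat (BAnd \<phi> \<psi>) x \<longleftrightarrow> bsat \<phi> x \<and> bsat \<psi> x"

definition sat_region :: "'x set \<Rightarrow> 'x bform \<Rightarrow> 'x set" where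
  "sat_region X \<phi> = {x \<in> X. bsat \<phi> x}"

text \<open>A formula is identified with its syntax tree. Conjunctions are n-ary; nothing below
  depends on the order of the children of a conjunction node.\<close>

datatype 'x stl =
    Region "'x set"
  | Conj "'x stl list"
  | Globally nat nat "'x stl"
  | Until nat nat "'x stl" "'x stl"

fun wf_stl :: "'x set \<Rightarrow> 'x stl \<Rightarrow> bool" where
  "wf_stl X (Region H) \<longleftrightarrow> (\<exists>\<phi>. H = sat_region X \<phi>)"
| "wf_stl X (Conj \<Phi>s) \<longleftrightarrow> \<Phi>s \<noteq> [] \<and> (\<forall>\<Phi>\<in>set \<Phi>s. wf_stl X \<Phi>)"
| "wf_stl X (Globally a b \<Phi>) \<longleftrightarrow> a \<le> b \<and> wf_stl X \<Phi>"
| "wf_stl X (Until a b \<Phi> \<Psi>) \<longleftrightarrow> a \<le> b \<and> wf_stl X \<Phi> \<and> wf_stl X \<Psi>"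

text \<open>Satisfaction on a finite state sequence. It is meaningful only if the sequence is long
  enough that every \<open>xs ! k\<close> that is accessed exists.\<close>

fun sat :: "'x list \<Rightarrow> nat \<Rightarrow> 'x stl \<Rightarrow> bool" where
  "sat xs k (Region H) \<longleftrightarrow> xs ! k \<in> H"
| "sat xs k (Conj \<Phi>s) \<longleftrightarrow> (\<forall>\<Phi>\<in>set \<Phi>s. sat xs k \<Phi>)"
| "sat xs k (Globally a b \<Phi>) \<longleftrightarrow> (\<forall>k'\<in>{k+a..k+b}. sat xs k' \<Phi>)"
| "sat xs k (Until a b \<Phi> \<Psi>) \<longleftrightarrow>
     (\<exists>k'\<in>{k+a..k+b}. sat xs k' \<Psi> \<and> (\<forall>k''\<in>{k+a..k'}. sat xs k'' \<Phi>))"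

fun traj :: "('x \<Rightarrow> 'u \<Rightarrow> 'x) \<Rightarrow> 'x \<Rightarrow> 'u list \<Rightarrow> 'x list" where
  "traj f x [] = []"
| "traj f x (u # us) = f x u # traj f (f x u) us"

text \<open>Inputs remaining at instant \<open>k\<close>: the sequences \<open>u\<^sub>k \<dots> u\<^bsub>T-1\<^esub>\<close>.\<close>

definition inputs :: "'u set \<Rightarrow> nat \<Rightarrow> nat \<Rightarrow> 'u list set" where
  "inputs U T k = {us. length us = T - k \<and> set us \<subseteq> U}"

text \<open>A prefix \<open>x\<^sub>0 \<dots> x\<^sub>k\<close> is a list of length \<open>k + 1\<close>.\<close>

definition violated :: "('x \<Rightarrow> 'u \<Rightarrow> 'x) \<Rightarrow> 'u set \<Rightarrow> nat \<Rightarrow> 'x stl \<Rightarrow> 'x list \<Rightarrow> bool" where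
  "violated f U T \<Phi> xs \<longleftrightarrow>
     (\<forall>us\<in>inputs U T (length xs - 1). \<not> sat (xs @ traj f (last xs) us) 0 \<Phi>)"

definition feasible :: "('x \<Rightarrow> 'u \<Rightarrow> 'x) \<Rightarrow> 'u set \<Rightarrow> nat \<Rightarrow> 'x stl \<Rightarrow> 'x list \<Rightarrow> bool" where
  "feasible f U T \<Phi> xs \<longleftrightarrow>
     (\<exists>us\<in>inputs U T (length xs - 1). sat (xs @ traj f (last xs) us) 0 \<Phi>)"

text \<open>Nodes of the syntax tree are addressed by the path of child indices from the root, so that
  equal subformulas at different places are different nodes. The strict ancestors of \<open>v\<close> are the
  nodes \<open>take i v\<close> with \<open>i < length v\<close>.\<close>

type_synonym node = "nat list"

fun children :: "'x stl \<Rightarrow> 'x stl list" where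
  "children (Region H) = []"
| "children (Conj \<Phi>s) = \<Phi>s"
| "children (Globally a b \<Phi>) = [\<Phi>]"
| "children (Until a b \<Phi> \<Psi>) = [\<Phi>, \<Psi>]"

fun is_node :: "'x stl \<Rightarrow> node \<Rightarrow> bool" where
  "is_node \<Phi> [] \<longleftrightarrow> True"
| "is_node \<Phi> (i # v) \<longleftrightarrow> i < length (children \<Phi>) \<and> is_node (children \<Phi> ! i) v"

fun subformula_at :: "'x stl \<Rightarrow> node \<Rightarrow> 'x stl" where
  "subformula_at \<Phi> [] = \<Phi>"
| "subformula_at \<Phi> (i # v) = subformula_at (children \<Phi> ! i) v"

fun interval_lo :: "'x stl \<Rightarrow> nat" where
  "interval_lo (Globally a b \<Phi>) = a"
| "interval_lo (Until a b \<Phi> \<Psi>) = a"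
| "interval_lo _ = 0"

fun interval_hi :: "'x stl \<Rightarrow> nat" where
  "interval_hi (Globally a b \<Phi>) = b"
| "interval_hi (Until a b \<Phi> \<Psi>) = b"
| "interval_hi _ = 0"

definition eval_start :: "'x stl \<Rightarrow> node \<Rightarrow> nat" where
  "eval_start \<Phi> v = (\<Sum>i<length v. interval_lo (subformula_at \<Phi> (take i v)))"

definition eval_end :: "'x stl \<Rightarrow> node \<Rightarrow> nat" where
  "eval_end \<Phi> v = (\<Sum>i<length v. interval_hi (subformula_at \<Phi> (take i v)))"

definition hnode_region :: "'x stl \<Rightarrow> node \<Rightarrow> 'x set \<Rightarrow> bool" where
  "hnode_region \<Phi> v H \<longleftrightarrow> is_node \<Phi> v \<and> subformula_at \<Phi> v = Region H"

definition horizon_suffices :: "'x stl \<Rightarrow> nat \<Rightarrow> bool" where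
  "horizon_suffices \<Phi> T \<longleftrightarrow> (\<forall>v H. hnode_region \<Phi> v H \<longrightarrow> eval_end \<Phi> v \<le> T)"

datatype entry = Zero | One | Unknown

text \<open>A basic set maps an \<open>\<H>\<close>-node \<open>v\<close> and an instant \<open>t\<close> in the evaluation horizon of \<open>v\<close> to an
  entry. At all other arguments it is \<open>Unknown\<close>, so that basic sets obtained by updates are equal
  as functions iff they are equal as tuples of satisfaction vectors.\<close>

type_synonym basic_set = "node \<Rightarrow> nat \<Rightarrow> entry"

definition init_basic :: basic_set where
  "init_basic = (\<lambda>v t. Unknown)"

definition update :: "'x stl \<Rightarrow> nat \<Rightarrow> basic_set \<Rightarrow> 'x \<Rightarrow> basic_set" where
  "update \<Phi> k I x = (\<lambda>v t.
     case subformula_at \<Phi> v of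
       Region H \<Rightarrow>
         (if is_node \<Phi> v \<and> t \<in> {eval_start \<Phi> v..eval_end \<Phi> v} \<and> t = k
          then (if x \<in> H then One else Zero)
          else I v t)
     | _ \<Rightarrow> I v t)"

definition basic_of :: "'x stl \<Rightarrow> 'x list \<Rightarrow> basic_set" where
  "basic_of \<Phi> xs = fold (\<lambda>k I. update \<Phi> k I (xs ! k)) [0..<length xs] init_basic"

text \<open>\<open>sat_vec I v \<Psi> t\<close> is the entry at \<open>t\<close> of the satisfaction vector induced by \<open>I\<close> at the
  node \<open>v\<close>, where \<open>\<Psi>\<close> is the subformula at \<open>v\<close>.\<close>

function sat_vec :: "basic_set \<Rightarrow> node \<Rightarrow> 'x stl \<Rightarrow> nat \<Rightarrow> entry" where
  "sat_vec I v (Region H) t = I v t"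
| "sat_vec I v (Conj \<Phi>s) t =
     (if \<exists>i\<in>{..<length \<Phi>s}. sat_vec I (v @ [i]) (\<Phi>s ! i) t = Zero then Zero
      else if \<forall>i\<in>{..<length \<Phi>s}. sat_vec I (v @ [i]) (\<Phi>s ! i) t = One then One
      else Unknown)"
| "sat_vec I v (Globally a b \<Phi>) t =
     (if \<exists>t'\<in>{a..b}. sat_vec I (v @ [0]) \<Phi> (t + t') = Zero then Zero
      else if \<forall>t'\<in>{a..b}. sat_vec I (v @ [0]) \<Phi> (t + t') = One then One
      else Unknown)"
| "sat_vec I v (Until a b \<Phi> \<Psi>) t =
     (if (\<forall>t'\<in>{a..b}. sat_vec I (v @ [1]) \<Psi> (t + t') = Zero) \<or>
         (\<forall>t'\<in>{a..b}. sat_vec I (v @ [1]) \<Psi> (t + t') = One \<longrightarrow>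
            (\<exists>t''\<in>{a..t'}. sat_vec I (v @ [0]) \<Phi> (t + t'') = Zero)) then Zero
      else if \<exists>t'\<in>{a..b}. sat_vec I (v @ [1]) \<Psi> (t + t') = One \<and>
         (\<forall>t''\<in>{a..t'}. sat_vec I (v @ [0]) \<Phi> (t + t'') = One) then One
      else Unknown)"
  by pat_completeness auto
termination
  by (relation "Wellfounded.measure (\<lambda>(I, v, \<Phi>, t). size \<Phi>)")
     (auto simp: less_Suc_eq_le intro!: size_list_estimation' nth_mem)

definition root_entry :: "'x stl \<Rightarrow> basic_set \<Rightarrow> entry" where
  "root_entry \<Phi> I = sat_vec I [] \<Phi> 0"

definition prefixes_with_basic :: "'x set \<Rightarrow> 'x stl \<Rightarrow> nat \<Rightarrow> basic_set \<Rightarrow> 'x list set" where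
  "prefixes_with_basic X \<Phi> k I = {xs. length xs = k \<and> set xs \<subseteq> X \<and> basic_of \<Phi> xs = I}"

definition feasible_set ::
  "('x \<Rightarrow> 'u \<Rightarrow> 'x) \<Rightarrow> 'x set \<Rightarrow> 'u set \<Rightarrow> nat \<Rightarrow> 'x stl \<Rightarrow> nat \<Rightarrow> basic_set \<Rightarrow> 'x set" where
  "feasible_set f X U T \<Phi> k I =
     {x \<in> X. \<exists>us\<in>inputs U T k. \<exists>xs'\<in>prefixes_with_basic X \<Phi> k I.
        sat (xs' @ [x] @ traj f x us) 0 \<Phi>}"

datatype verdict = Vio | Feas

text \<open>\<open>decisions F \<Phi> k I xs\<close> lists the decisions issued by the monitoring loop when it is entered
  with instant \<open>k\<close> and basic set \<open>I\<close>, with the precomputed sets \<open>F\<close>, and then observes \<open>xs\<close>. The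
  list is shorter than \<open>xs\<close> if the loop terminates earlier.\<close>

fun decisions ::
  "(nat \<Rightarrow> basic_set \<Rightarrow> 'x set) \<Rightarrow> 'x stl \<Rightarrow> nat \<Rightarrow> basic_set \<Rightarrow> 'x list \<Rightarrow> verdict list" where
  "decisions F \<Phi> k I [] = []"
| "decisions F \<Phi> k I (x # xs) =
     (if root_entry \<Phi> I = One then []
      else if x \<notin> F k I then [Vio]
      else Feas # decisions F \<Phi> (Suc k) (update \<Phi> k I x) xs)"

text \<open>The decision issued at the last instant of the prefix; if the loop has terminated before, its
  final decision stays in force.\<close>

definition monitor ::
  "('x \<Rightarrow> 'u \<Rightarrow> 'x) \<Rightarrow> 'x set \<Rightarrow> 'u set \<Rightarrow> nat \<Rightarrow> 'x stl \<Rightarrow> 'x list \<Rightarrow> verdict" where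
  "monitor f X U T \<Phi> xs = last (decisions (feasible_set f X U T \<Phi>) \<Phi> 0 init_basic xs)"

end

theory Submission
  imports Defs
begin

text \<open>The monitor replaces the observed prefix by the basic set it induces, and two facts make
  this replacement harmless. \<^emph>\<open>Losslessness:\<close> the formula inspects the state at instant \<open>t\<close> only
  through the regions of those \<open>\<H>\<close>-nodes whose evaluation horizon contains \<open>t\<close>, and this is exactly
  the information a basic set records. Hence prefixes of equal length with equal basic sets are
  interchangeable (\<open>sat_append_cong_basic_of\<close>), and membership of the current state in the feasible
  set decides feasibility of the prefix actually observed (\<open>mem_feasible_set_iff\<close>).
  \<^emph>\<open>Soundness of early acceptance:\<close> operators occur only positively in the fragment, so an entry
  \<open>One\<close> is always traced back to entries \<open>One\<close> of \<open>\<H>\<close>-nodes, and a root entry \<open>One\<close> means that every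
  continuation of the prefix satisfies the formula (\<open>root_entry_One_imp_sat\<close>). Nothing of the
  kind is claimed for \<open>Zero\<close>: with all entries unknown an until node evaluates to \<open>Zero\<close>, because
  its second condition holds vacuously. The loop only ever compares the root entry with \<open>One\<close>.

  The verdict is then correct by induction on the prefix. While the loop runs, the feasible
  sets give the answer. After \<open>Vio\<close>, the state moves along the dynamics, and a feasible
  extension would yield feasibility of the shorter prefix by prepending the input just used. After
  early acceptance the formula holds on every continuation, so that only the existence of an
  input sequence is at stake; the feasible shorter prefix supplies an input.\<close>

section \<open>Evaluation horizons along the syntax tree\<close>

lemma eval_start_Nil [simp]: "eval_start \<Phi> [] = 0"
  by (simp add: eval_start_def)

lemma eval_end_Nil [simp]: "eval_end \<Phi> [] = 0"
  by (simp add: eval_end_def)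

lemma eval_start_Cons [simp]:
  "eval_start \<Phi> (i # v) = interval_lo \<Phi> + eval_start (children \<Phi> ! i) v"
  by (simp add: eval_start_def sum.lessThan_Suc_shift del: sum.lessThan_Suc)

lemma eval_end_Cons [simp]:
  "eval_end \<Phi> (i # v) = interval_hi \<Phi> + eval_end (children \<Phi> ! i) v"
  by (simp add: eval_end_def sum.lessThan_Suc_shift del: sum.lessThan_Suc)

lemma hnode_region_Nil [simp]: "hnode_region \<Phi> [] H \<longleftrightarrow> \<Phi> = Region H"
  by (simp add: hnode_region_def)

lemma hnode_region_Cons [simp]:
  "hnode_region \<Phi> (i # v) H \<longleftrightarrow> i < length (children \<Phi>) \<and> hnode_region (children \<Phi> ! i) v H"
  by (simp add: hnode_region_def)

section \<open>Which states a formula inspects\<close>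

text \<open>The horizons of the nodes of a subformula are relative to its own root, so for the induction
  the subformula is evaluated at any instant of a window \<open>{lo..hi}\<close>; passing to a child widens
  the window by the interval of the operator, which is how evaluation horizons accumulate.\<close>

lemma sat_cong_on_horizons:
  assumes "\<And>w H t. hnode_region \<Psi> w H \<Longrightarrow> t \<in> {lo + eval_start \<Psi> w..hi + eval_end \<Psi> w} \<Longrightarrow>
             xs ! t \<in> H \<longleftrightarrow> ys ! t \<in> H"
    and "t \<in> {lo..hi}"
  shows "sat xs t \<Psi> \<longleftrightarrow> sat ys t \<Psi>"
  using assms
proof (induction \<Psi> arbitrary: lo hi t)
  case (Region H)
  show ?case using Region.prems(1)[of "[]" H t] Region.prems(2) by simp
next
  case (Conj \<Phi>s)
  have "sat xs t \<Phi> \<longleftrightarrow> sat ys t \<Phi>" if "\<Phi> \<in> set \<Phi>s" for \<Phi>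
  proof -
    from that obtain i where i: "i < length \<Phi>s" "\<Phi> = \<Phi>s ! i"
      by (auto simp: in_set_conv_nth)
    show ?thesis
    proof (rule Conj.IH[OF that _ Conj.prems(2)])
      fix w H s
      assume "hnode_region \<Phi> w H" "s \<in> {lo + eval_start \<Phi> w..hi + eval_end \<Phi> w}"
      then show "xs ! s \<in> H \<longleftrightarrow> ys ! s \<in> H"
        using Conj.prems(1)[of "i # w" H s] i by simp
    qed
  qed
  then show ?case by simp
next
  case (Globally a b \<Phi>)
  have "sat xs s \<Phi> \<longleftrightarrow> sat ys s \<Phi>" if "s \<in> {t + a..t + b}" for s
  proof (rule Globally.IH)
    fix w H r
    assume "hnode_region \<Phi> w H" "r \<in> {(lo + a) + eval_start \<Phi> w..(hi + b) + eval_end \<Phi> w}"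
    then show "xs ! r \<in> H \<longleftrightarrow> ys ! r \<in> H"
      using Globally.prems(1)[of "0 # w" H r] by (simp add: add.assoc)
  qed (use that Globally.prems(2) in auto)
  then show ?case by simp
next
  case (Until a b \<Phi> \<Psi>)
  have left: "sat xs s \<Phi> \<longleftrightarrow> sat ys s \<Phi>" if "s \<in> {t + a..t + b}" for s
  proof (rule Until.IH(1))
    fix w H r
    assume "hnode_region \<Phi> w H" "r \<in> {(lo + a) + eval_start \<Phi> w..(hi + b) + eval_end \<Phi> w}"
    then show "xs ! r \<in> H \<longleftrightarrow> ys ! r \<in> H"
      using Until.prems(1)[of "0 # w" H r] by (simp add: add.assoc)
  qed (use that Until.prems(2) in auto)
  have right: "sat xs s \<Psi> \<longleftrightarrow> sat ys s \<Psi>" if "s \<in> {t + a..t + b}" for s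
  proof (rule Until.IH(2))
    fix w H r
    assume "hnode_region \<Psi> w H" "r \<in> {(lo + a) + eval_start \<Psi> w..(hi + b) + eval_end \<Psi> w}"
    then show "xs ! r \<in> H \<longleftrightarrow> ys ! r \<in> H"
      using Until.prems(1)[of "Suc 0 # w" H r] by (simp add: add.assoc)
  qed (use that Until.prems(2) in auto)
  have "(\<forall>k''\<in>{t + a..k'}. sat xs k'' \<Phi>) \<longleftrightarrow> (\<forall>k''\<in>{t + a..k'}. sat ys k'' \<Phi>)"
    if "k' \<in> {t + a..t + b}" for k'
    by (rule ball_cong[OF refl], rule left) (use that in auto)
  with right show ?case by simp
qed

section \<open>What a basic set records\<close>

lemma basic_of_Nil [simp]: "basic_of \<Phi> [] = init_basic"
  by (simp add: basic_of_def)

lemma basic_of_snoc: "basic_of \<Phi> (xs @ [x]) = update \<Phi> (length xs) (basic_of \<Phi> xs) x"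
proof -
  have "fold (\<lambda>k I. update \<Phi> k I ((xs @ [x]) ! k)) [0..<length xs] init_basic =
        fold (\<lambda>k I. update \<Phi> k I (xs ! k)) [0..<length xs] init_basic"
    by (rule fold_cong) (auto simp: nth_append)
  then show ?thesis by (simp add: basic_of_def)
qed

lemma basic_of_hnode:
  assumes "hnode_region \<Phi> v H"
  shows "basic_of \<Phi> xs v t =
    (if t \<in> {eval_start \<Phi> v..eval_end \<Phi> v} \<and> t < length xs
     then if xs ! t \<in> H then One else Zero else Unknown)"
proof (induction xs rule: rev_induct)
  case Nil
  show ?case by (simp add: init_basic_def)
next
  case (snoc x xs)
  then show ?case using assms
    by (auto simp: basic_of_snoc update_def hnode_region_def nth_append)
qed

text \<open>This is the equivalence of ``some'' and ``all'' prefixes in the definition of the feasible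
  sets. Equal length is needed to align the common continuation \<open>zs\<close>.\<close>

lemma sat_append_cong_basic_of:
  assumes len: "length xs = length ys" and eq: "basic_of \<Phi> xs = basic_of \<Phi> ys"
  shows "sat (xs @ zs) 0 \<Phi> \<longleftrightarrow> sat (ys @ zs) 0 \<Phi>"
proof (rule sat_cong_on_horizons[where lo = 0 and hi = 0])
  fix w H t
  assume h: "hnode_region \<Phi> w H" and t: "t \<in> {0 + eval_start \<Phi> w..0 + eval_end \<Phi> w}"
  show "(xs @ zs) ! t \<in> H \<longleftrightarrow> (ys @ zs) ! t \<in> H"
  proof (cases "t < length xs")
    case True
    have "basic_of \<Phi> xs w t = basic_of \<Phi> ys w t" by (simp add: eq)
    with True t len show ?thesis
      by (simp add: basic_of_hnode[OF h] nth_append split: if_splits)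
  next
    case False
    with len show ?thesis by (simp add: nth_append)
  qed
qed simp

section \<open>Soundness of the entry One\<close>

lemma sat_vec_One_imp_sat:
  assumes "\<And>w H t. hnode_region \<Psi> w H \<Longrightarrow> I (v @ w) t = One \<Longrightarrow> xs ! t \<in> H"
    and "sat_vec I v \<Psi> t = One"
  shows "sat xs t \<Psi>"
  using assms
proof (induction \<Psi> arbitrary: v t)
  case (Region H)
  show ?case using Region.prems(1)[of "[]" H t] Region.prems(2) by simp
next
  case (Conj \<Phi>s)
  have "sat xs t (\<Phi>s ! i)" if i: "i < length \<Phi>s" for i
  proof (rule Conj.IH)
    show "\<Phi>s ! i \<in> set \<Phi>s" using i by simp
    show "sat_vec I (v @ [i]) (\<Phi>s ! i) t = One"
      using Conj.prems(2) i by (auto split: if_splits)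
  next
    fix w H s
    assume "hnode_region (\<Phi>s ! i) w H" "I ((v @ [i]) @ w) s = One"
    then show "xs ! s \<in> H" using Conj.prems(1)[of "i # w" H s] i by simp
  qed
  then show ?case by (auto simp: in_set_conv_nth)
next
  case (Globally a b \<Phi>)
  have child: "sat xs s \<Phi>" if "sat_vec I (v @ [0]) \<Phi> s = One" for s
  proof (rule Globally.IH[OF _ that])
    fix w H r
    assume "hnode_region \<Phi> w H" "I ((v @ [0]) @ w) r = One"
    then show "xs ! r \<in> H" using Globally.prems(1)[of "0 # w" H r] by simp
  qed
  have one: "\<forall>t'\<in>{a..b}. sat_vec I (v @ [0]) \<Phi> (t + t') = One"
    using Globally.prems(2) by (auto split: if_splits)
  have "sat xs k' \<Phi>" if "k' \<in> {t + a..t + b}" for k'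
  proof -
    from that have "k' - t \<in> {a..b}" "t + (k' - t) = k'" by auto
    then show ?thesis using one child by metis
  qed
  then show ?case by simp
next
  case (Until a b \<Phi> \<Psi>)
  have left: "sat xs s \<Phi>" if "sat_vec I (v @ [0]) \<Phi> s = One" for s
  proof (rule Until.IH(1)[OF _ that])
    fix w H r
    assume "hnode_region \<Phi> w H" "I ((v @ [0]) @ w) r = One"
    then show "xs ! r \<in> H" using Until.prems(1)[of "0 # w" H r] by simp
  qed
  have right: "sat xs s \<Psi>" if "sat_vec I (v @ [1]) \<Psi> s = One" for s
  proof (rule Until.IH(2)[OF _ that])
    fix w H r
    assume "hnode_region \<Psi> w H" "I ((v @ [1]) @ w) r = One"
    then show "xs ! r \<in> H" using Until.prems(1)[of "1 # w" H r] by simp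
  qed
  obtain t' where t': "t' \<in> {a..b}" "sat_vec I (v @ [1]) \<Psi> (t + t') = One"
    and all: "\<forall>t''\<in>{a..t'}. sat_vec I (v @ [0]) \<Phi> (t + t'') = One"
    using Until.prems(2) unfolding sat_vec.simps
    by (metis entry.distinct(1) entry.distinct(5))
  have "sat xs k'' \<Phi>" if "k'' \<in> {t + a..t + t'}" for k''
  proof -
    from that have "k'' - t \<in> {a..t'}" "t + (k'' - t) = k''" by auto
    then show ?thesis using all left by metis
  qed
  moreover have "t + t' \<in> {t + a..t + b}" using t'(1) by simp
  ultimately show ?case using right[OF t'(2)] unfolding sat.simps by blast
qed

text \<open>An entry \<open>One\<close> at an \<open>\<H>\<close>-node can only stem from an observed state, so the continuation
  \<open>ys\<close> is arbitrary.\<close>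

lemma root_entry_One_imp_sat:
  assumes "root_entry \<Phi> (basic_of \<Phi> xs) = One"
  shows "sat (xs @ ys) 0 \<Phi>"
proof (rule sat_vec_One_imp_sat)
  show "sat_vec (basic_of \<Phi> xs) [] \<Phi> 0 = One" using assms by (simp add: root_entry_def)
next
  fix w H t
  assume "hnode_region \<Phi> w H" "basic_of \<Phi> xs ([] @ w) t = One"
  then show "(xs @ ys) ! t \<in> H"
    by (simp add: basic_of_hnode nth_append split: if_splits)
qed

text \<open>The loop body is executed at least once. Well-formedness enters because an empty
  conjunction or an empty interval of a globally operator would evaluate to \<open>One\<close> vacuously.\<close>

lemma sat_vec_init_basic_neq_One:
  assumes "wf_stl X \<Psi>"
  shows "sat_vec init_basic v \<Psi> t \<noteq> One"
  using assms
proof (induction \<Psi> arbitrary: v t)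
  case (Region H)
  show ?case by (simp add: init_basic_def)
next
  case (Conj \<Phi>s)
  then have "0 < length \<Phi>s" "\<And>v t. sat_vec init_basic v (\<Phi>s ! 0) t \<noteq> One" by auto
  then show ?case by auto
next
  case (Globally a b \<Phi>)
  then have "a \<in> {a..b}" "\<And>v t. sat_vec init_basic v \<Phi> t \<noteq> One" by auto
  then show ?case by auto
next
  case (Until a b \<Phi> \<Psi>)
  then have "\<And>v t. sat_vec init_basic v \<Psi> t \<noteq> One" by auto
  then show ?case by auto
qed

section \<open>Feasible sets and feasible prefixes\<close>

lemma feasible_snoc:
  "feasible f U T \<Phi> (xs @ [x]) \<longleftrightarrow>
     (\<exists>us\<in>inputs U T (length xs). sat (xs @ [x] @ traj f x us) 0 \<Phi>)"
  by (simp add: feasible_def)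

lemma violated_iff_not_feasible: "violated f U T \<Phi> xs \<longleftrightarrow> \<not> feasible f U T \<Phi> xs"
  by (simp add: violated_def feasible_def)

lemma mem_feasible_set_iff:
  assumes "set xs \<subseteq> X" "x \<in> X"
  shows "x \<in> feasible_set f X U T \<Phi> (length xs) (basic_of \<Phi> xs) \<longleftrightarrow>
         feasible f U T \<Phi> (xs @ [x])"
proof -
  have self: "xs \<in> prefixes_with_basic X \<Phi> (length xs) (basic_of \<Phi> xs)"
    using assms(1) by (simp add: prefixes_with_basic_def)
  have "sat (xs' @ zs) 0 \<Phi> \<longleftrightarrow> sat (xs @ zs) 0 \<Phi>"
    if "xs' \<in> prefixes_with_basic X \<Phi> (length xs) (basic_of \<Phi> xs)" for xs' zs
    using that by (intro sat_append_cong_basic_of) (auto simp: prefixes_with_basic_def)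
  with self assms(2) show ?thesis
    unfolding feasible_snoc feasible_set_def by blast
qed

text \<open>Feasibility propagates backwards along the dynamics: the input that led to the last state is
  prepended to the remaining inputs.\<close>

lemma feasible_butlast:
  assumes "feasible f U T \<Phi> (xs @ [f (last xs) u])" "xs \<noteq> []" "length xs \<le> T" "u \<in> U"
  shows "feasible f U T \<Phi> xs"
proof -
  obtain us where us: "us \<in> inputs U T (length xs)"
    and sat: "sat (xs @ [f (last xs) u] @ traj f (f (last xs) u) us) 0 \<Phi>"
    using assms(1) by (auto simp: feasible_snoc)
  have "u # us \<in> inputs U T (length xs - 1)"
    using us assms(2-4) by (cases xs) (auto simp: inputs_def)
  then show ?thesis using sat unfolding feasible_def
    by (intro bexI[of _ "u # us"]) auto
qed

section \<open>The monitoring loop\<close>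

lemma last_decisions_eq_Vio: "Vio \<in> set (decisions F \<Phi> k I xs) \<Longrightarrow> last (decisions F \<Phi> k I xs) = Vio"
  by (induction F \<Phi> k I xs rule: decisions.induct) (auto split: if_splits)

text \<open>The acceptance case carries the accepting prefix as a witness: soundness of \<open>One\<close> applies to
  it and thereby to every longer prefix, so the root entry need not be followed through later
  updates. The loop is entered after an arbitrary prefix \<open>p\<close>, because each pass of the loop moves
  one state from \<open>q\<close> to \<open>p\<close>.\<close>

lemma decisions_snoc:
  fixes F :: "nat \<Rightarrow> basic_set \<Rightarrow> 'x set" and \<Phi> :: "'x stl" and p q :: "'x list"
  defines "D \<equiv> decisions F \<Phi> (length p) (basic_of \<Phi> p)"
  shows "(Vio \<in> set (D q) \<and> D (q @ [x]) = D q) \<or>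
         ((\<exists>i. root_entry \<Phi> (basic_of \<Phi> (p @ take i q)) = One) \<and> D (q @ [x]) = D q) \<or>
         D (q @ [x]) = D q @ [if x \<in> F (length (p @ q)) (basic_of \<Phi> (p @ q)) then Feas else Vio]"
  unfolding D_def
proof (induction q arbitrary: p)
  case Nil
  show ?case by auto
next
  case (Cons y q)
  consider "root_entry \<Phi> (basic_of \<Phi> p) = One"
    | "root_entry \<Phi> (basic_of \<Phi> p) \<noteq> One" "y \<notin> F (length p) (basic_of \<Phi> p)"
    | "root_entry \<Phi> (basic_of \<Phi> p) \<noteq> One" "y \<in> F (length p) (basic_of \<Phi> p)"
    by blast
  then show ?case
  proof cases
    case 1
    then have "root_entry \<Phi> (basic_of \<Phi> (p @ take 0 (y # q))) = One" by simp
    with 1 show ?thesis by (metis append_Cons decisions.simps(2))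
  next
    case 2
    then show ?thesis by simp
  next
    case 3
    have shift: "(\<exists>i. root_entry \<Phi> (basic_of \<Phi> ((p @ [y]) @ take i q)) = One) \<Longrightarrow>
        (\<exists>i. root_entry \<Phi> (basic_of \<Phi> (p @ take i (y # q))) = One)"
      by (metis append.assoc append_Cons append_Nil take_Suc_Cons)
    show ?thesis
      using Cons.IH[of "p @ [y]"] shift 3 by (auto simp: basic_of_snoc)
  qed
qed

lemma monitor_singleton:
  assumes "wf_stl X \<Phi>"
  shows "monitor f X U T \<Phi> [x] =
    (if x \<in> feasible_set f X U T \<Phi> 0 init_basic then Feas else Vio)"
  using sat_vec_init_basic_neq_One[OF assms] by (simp add: monitor_def root_entry_def)

lemma monitor_snoc:
  assumes "xs \<noteq> []"
  obtains (violated) "monitor f X U T \<Phi> xs = Vio" "monitor f X U T \<Phi> (xs @ [x]) = Vio"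
  | (accepted) i where "monitor f X U T \<Phi> (xs @ [x]) = monitor f X U T \<Phi> xs"
      "root_entry \<Phi> (basic_of \<Phi> (take i xs)) = One"
  | (running) "monitor f X U T \<Phi> (xs @ [x]) =
      (if x \<in> feasible_set f X U T \<Phi> (length xs) (basic_of \<Phi> xs) then Feas else Vio)"
  using decisions_snoc[of "feasible_set f X U T \<Phi>" \<Phi> "[]" xs x]
    last_decisions_eq_Vio[of "feasible_set f X U T \<Phi>" \<Phi> 0 init_basic xs]
  by (auto simp: monitor_def)

text \<open>The dynamics are required at the instants whose own verdict is \<open>Vio\<close>. Since \<open>Vio\<close> persists,
  these are all instants from the first \<open>Vio\<close> on, and the induction on the prefix needs to look
  only at the verdict one instant earlier.\<close>

lemma monitor_eq_Feas_iff_feasible: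
  assumes "wf_stl X \<Phi>" "xs \<noteq> []" "length xs \<le> Suc T" "set xs \<subseteq> X"
    and "\<And>i. Suc i < length xs \<Longrightarrow> monitor f X U T \<Phi> (take (Suc i) xs) = Vio \<Longrightarrow>
           \<exists>u\<in>U. xs ! Suc i = f (xs ! i) u"
  shows "monitor f X U T \<Phi> xs = Feas \<longleftrightarrow> feasible f U T \<Phi> xs"
  using assms(2-)
proof (induction xs rule: rev_induct)
  case Nil
  then show ?case by simp
next
  case (snoc x xs)
  have X: "set xs \<subseteq> X" "x \<in> X" using snoc.prems(3) by auto
  have T: "length xs \<le> T" using snoc.prems(2) by simp
  show ?case
  proof (cases "xs = []")
    case True
    have "x \<in> feasible_set f X U T \<Phi> 0 init_basic \<longleftrightarrow> feasible f U T \<Phi> [x]"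
      using mem_feasible_set_iff[of "[]" X x f U T \<Phi>] X(2) by simp
    with True monitor_singleton[OF assms(1), of f U T x] show ?thesis by simp
  next
    case False
    have IH: "monitor f X U T \<Phi> xs = Feas \<longleftrightarrow> feasible f U T \<Phi> xs"
    proof (rule snoc.IH[OF False _ X(1)])
      fix i
      assume "Suc i < length xs" "monitor f X U T \<Phi> (take (Suc i) xs) = Vio"
      then show "\<exists>u\<in>U. xs ! Suc i = f (xs ! i) u"
        using snoc.prems(4)[of i] by (simp add: nth_append)
    qed (use T in simp)
    have stays_infeasible: "\<not> feasible f U T \<Phi> (xs @ [x])" if vio: "monitor f X U T \<Phi> xs = Vio"
    proof
      assume feas: "feasible f U T \<Phi> (xs @ [x])"
      have len: "Suc (length xs - 1) = length xs" using False by simp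
      obtain u where "u \<in> U" "x = f (last xs) u"
        using snoc.prems(4)[of "length xs - 1"] vio False len
        by (auto simp: nth_append last_conv_nth)
      then have "feasible f U T \<Phi> xs"
        using feasible_butlast feas False T by metis
      with IH vio show False by simp
    qed
    from False show ?thesis
    proof (cases rule: monitor_snoc[where x = x and f = f and X = X and U = U and T = T and \<Phi> = \<Phi>])
      case violated
      with stays_infeasible show ?thesis by simp
    next
      case (accepted i)
      show ?thesis
      proof (cases "monitor f X U T \<Phi> xs")
        case Vio
        with accepted(1) stays_infeasible show ?thesis by simp
      next
        case Feas
        then have "feasible f U T \<Phi> xs" using IH by simp
        then obtain us where "us \<in> inputs U T (length xs - 1)"
          by (auto simp: feasible_def)
        \<comment> \<open>Dropping the first of the inputs that remain one instant earlier shows that inputs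
            remain now.\<close>
        then have "tl us \<in> inputs U T (length xs)"
          using False T by (cases us; cases xs) (auto simp: inputs_def)
        moreover have "sat (xs @ zs) 0 \<Phi>" for zs
          using root_entry_One_imp_sat[OF accepted(2), of "drop i xs @ zs"]
          by (simp flip: append_assoc)
        ultimately have "feasible f U T \<Phi> (xs @ [x])"
          by (auto simp: feasible_snoc)
        with Feas accepted(1) show ?thesis by simp
      qed
    next
      case running
      with mem_feasible_set_iff[OF X, of f U T \<Phi>] show ?thesis by simp
    qed
  qed
qed

theorem theorem1:
  fixes X :: "(real ^ 'n) set" and U :: "(real ^ 'm) set"
    and f :: "real ^ 'n \<Rightarrow> real ^ 'm \<Rightarrow> real ^ 'n"
    and T k :: nat and \<Phi> :: "(real ^ 'n) stl" and xs :: "(real ^ 'n) list"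
  assumes "bounded X" and "bounded U"
    and "\<And>x u. x \<in> X \<Longrightarrow> u \<in> U \<Longrightarrow> f x u \<in> X"
    and "continuous_on (X \<times> U) (\<lambda>(x, u). f x u)"
    and "wf_stl X \<Phi>"
    and "horizon_suffices \<Phi> T"
    and "k \<le> T" and "length xs = Suc k" and "set xs \<subseteq> X"
    \<comment> \<open>The prefix is arbitrary, except that once the algorithm has terminated with \<open>Vio\<close> at an
        instant \<open>j < k\<close>, the states after \<open>x\<^sub>j\<close> follow the dynamics. Without this the claim is false:
        the loop issues nothing after \<open>Vio\<close>, but a state that is not a successor of \<open>x\<^sub>j\<close> may make
        a violated prefix feasible again.\<close>
    and "\<And>j i. j \<le> i \<Longrightarrow> i < k \<Longrightarrow> monitor f X U T \<Phi> (take (Suc j) xs) = Vio \<Longrightarrow>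
           \<exists>u\<in>U. xs ! Suc i = f (xs ! i) u"
  shows "(monitor f X U T \<Phi> xs = Vio \<longleftrightarrow> violated f U T \<Phi> xs) \<and>
         (monitor f X U T \<Phi> xs = Feas \<longleftrightarrow> feasible f U T \<Phi> xs)"
proof -
  have "xs \<noteq> []" "length xs \<le> Suc T" using assms(7,8) by auto
  then have feas: "monitor f X U T \<Phi> xs = Feas \<longleftrightarrow> feasible f U T \<Phi> xs"
    using assms(5,8-10) by (intro monitor_eq_Feas_iff_feasible) auto
  then have "monitor f X U T \<Phi> xs = Vio \<longleftrightarrow> violated f U T \<Phi> xs"
    unfolding violated_iff_not_feasible by (metis verdict.distinct(1) verdict.exhaust)
  with feas show ?thesis by blast
qed

end
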